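(* Let $\alpha>0$, let $\phi(z)=\phi(0)+\lambda z$ with $\phi(0),\lambda\in\mathbb C$, and let $\psi(z)=ce^{dz}$, where $c,d\in\mathbb C$ and $c\neq 0$. (i) For $m\in(0,1)$, $C_{\psi,\phi}$ is bounded on $F^2_{\alpha,m}(\mathbb C)$ if and only if $|\lambda|\le 1$ and $d=0$. (ii) For $m>1$, $C_{\psi,\phi}$ is bounded on $F^2_{\alpha,m}(\mathbb C)$ if $|\lambda|<1$.
   Context: For $m>0$ and $\alpha>0$, the weighted Fock space $F^2_{\alpha,m}(\mathbb C)$ is the Hilbert space of all entire functions on $\mathbb C$ that are square integrable with respect to the measure $d\mu_{\alpha,m}(z)=\frac{m\alpha^{2/m}}{2\pi\Gamma(2/m)}e^{-\alpha|z|^m}\,dA(z)$, where $dA$ is Lebesgue measure on $\mathbb C$ and $\Gamma$ is the Euler gamma function; its inner product is $\langle f,g\rangle_{\alpha,m}=\int_{\mathbb C} f\overline{g}\,d\mu_{\alpha,m}$ and its norm is $\|\cdot\|_{\alpha,m}$. For entire functions $\psi$ and $\phi$, the weighted composition operator is $C_{\psi,\phi}f=\psi\cdot(f\circ\phi)$. Saying that it is bounded on $F^2_{\alpha,m}(\mathbb C)$ means that it maps $F^2_{\alpha,m}(\mathbb C)$ into itself and is a bounded linear operator there. *)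

theory Defs
  imports "HOL-Complex_Analysis.Complex_Analysis"
begin

definition fock_measure :: "real \<Rightarrow> real \<Rightarrow> complex measure" where
  "fock_measure \<alpha> m = density lborel
     (\<lambda>z. ennreal (m * \<alpha> powr (2 / m) / (2 * pi * Gamma (2 / m))
                   * exp (- \<alpha> * cmod z powr m)))"

definition fock_space :: "real \<Rightarrow> real \<Rightarrow> (complex \<Rightarrow> complex) set" where
  "fock_space \<alpha> m =
     {f. f holomorphic_on UNIV \<and> integrable (fock_measure \<alpha> m) (\<lambda>z. (cmod (f z))\<^sup>2)}"

definition fock_inner ::
    "real \<Rightarrow> real \<Rightarrow> (complex \<Rightarrow> complex) \<Rightarrow> (complex \<Rightarrow> complex) \<Rightarrow> complex" where
  "fock_inner \<alpha> m f g = (LINT z|fock_measure \<alpha> m. f z * cnj (g z))"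

definition fock_norm :: "real \<Rightarrow> real \<Rightarrow> (complex \<Rightarrow> complex) \<Rightarrow> real" where
  "fock_norm \<alpha> m f = sqrt (Re (fock_inner \<alpha> m f f))"

definition weighted_comp ::
    "(complex \<Rightarrow> complex) \<Rightarrow> (complex \<Rightarrow> complex) \<Rightarrow> (complex \<Rightarrow> complex) \<Rightarrow> complex \<Rightarrow> complex" where
  "weighted_comp \<psi> \<phi> f = (\<lambda>z. \<psi> z * (f \<circ> \<phi>) z)"

(* The library's bounded_linear needs a normed-space type; the Fock space is only a set of
   functions here, so boundedness is spelled out relative to that set. *)
definition fock_bounded ::
    "real \<Rightarrow> real \<Rightarrow> ((complex \<Rightarrow> complex) \<Rightarrow> complex \<Rightarrow> complex) \<Rightarrow> bool" where
  "fock_bounded \<alpha> m T \<longleftrightarrow>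
     (\<forall>f\<in>fock_space \<alpha> m. T f \<in> fock_space \<alpha> m) \<and>
     (\<forall>f\<in>fock_space \<alpha> m. \<forall>g\<in>fock_space \<alpha> m. \<forall>a b.
        T (\<lambda>z. a * f z + b * g z) = (\<lambda>z. a * T f z + b * T g z)) \<and>
     (\<exists>C. \<forall>f\<in>fock_space \<alpha> m. fock_norm \<alpha> m (T f) \<le> C * fock_norm \<alpha> m f)"

end

theory Submission
  imports Defs "HOL-Real_Asymp.Real_Asymp" "HOL-Probability.Sinc_Integral"
begin

text \<open>
Write \<open>\<phi> z = b + l * z\<close>. If \<open>l \<noteq> 0\<close>, substituting \<open>w = \<phi> z\<close> (\<open>fock_energy_affine_le\<close>)
reduces boundedness to the pointwise inequality
\<open>(cmod (\<psi> z))\<^sup>2 * exp (- \<alpha> * cmod z powr m) \<le> K * exp (- \<alpha> * cmod (\<phi> z) powr m)\<close>.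
For \<open>m < 1\<close>, \<open>cmod l \<le> 1\<close> and \<open>d = 0\<close>, this follows from subadditivity of \<open>t powr m\<close>
(\<open>weight_bound_sublinear\<close>). For \<open>m > 1\<close> and \<open>cmod l < 1\<close>, the difference
\<open>cmod z powr m - cmod (\<phi> z) powr m\<close> grows at least like a positive multiple of \<open>cmod z powr m\<close>
and so dominates the linear exponent of \<open>\<psi>\<close> (\<open>weight_bound_superlinear\<close>). If \<open>l = 0\<close>, the operator
has rank one and is bounded because \<open>\<psi>\<close> lies in the space and evaluation at \<open>b\<close> is continuous
(\<open>point_evaluation_bound\<close>).

Conversely, let \<open>m < 1\<close> and let the operator be bounded. Its value at the constant function 1 is \<open>\<psi>\<close>,
so \<open>\<psi>\<close> lies in the space, and the growth limit implied by the point evaluation bound forces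
\<open>d = 0\<close> (\<open>exp_linear_in_fock_space_imp_constant\<close>). Then the images of the monomials are multiples of
\<open>(b + l * z) ^ n\<close>, whose squared norm is at least \<open>cmod l ^ (2 * n) / 2\<close> times that of \<open>z ^ n\<close>
(\<open>affine_power_energy_ge\<close>), and letting \<open>n\<close> tend to infinity gives \<open>cmod l \<le> 1\<close>.

The analytic input is the area mean value inequality, derived from Cauchy's formula on circles and
rotation invariance of Lebesgue measure on the plane (\<open>ball_mean_square\<close>).
\<close>

section \<open>Lebesgue measure on the complex plane\<close>

lemma borel_measurable_Complex [measurable (raw)]:
  assumes [measurable]: "g \<in> borel_measurable M" "h \<in> borel_measurable M"
  shows "(\<lambda>x. Complex (g x) (h x)) \<in> borel_measurable M"
  unfolding Complex_eq by measurable

text \<open>Iterated integration in real and imaginary part is what makes one-dimensional substitutions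
available on the complex plane.\<close>
lemma nn_integral_lborel_complex:
  fixes f :: "complex \<Rightarrow> ennreal"
  assumes [measurable]: "f \<in> borel_measurable borel"
  shows "(\<integral>\<^sup>+z. f z \<partial>lborel) = (\<integral>\<^sup>+x. \<integral>\<^sup>+y. f (Complex x y) \<partial>lborel \<partial>lborel)"
proof -
  let ?C = "\<lambda>p::real \<times> real. Complex (fst p) (snd p)"
  have C_meas [measurable]: "?C \<in> borel_measurable borel"
    unfolding Complex_eq by (intro borel_measurable_continuous_onI continuous_intros)
  have "distr (lborel :: (real \<times> real) measure) borel ?C = lborel"
  proof (rule lborel_eqI[symmetric])
    fix l u :: complex
    assume lu: "\<And>b. b \<in> Basis \<Longrightarrow> l \<bullet> b \<le> u \<bullet> b"
    have "?C -` box l u = box (Re l, Im l) (Re u, Im u)"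
      by (auto simp: mem_box Basis_complex_def Basis_prod_def)
    moreover have "Re l \<le> Re u" "Im l \<le> Im u"
      using lu[of 1] lu[of \<i>] by (auto simp: Basis_complex_def)
    moreover have "((1::real), 0::real) \<noteq> (0, 1)"
      by simp
    ultimately have "emeasure lborel (?C -` box l u) = ennreal ((Re u - Re l) * (Im u - Im l))"
      by (auto simp: Basis_prod_def emeasure_lborel_box_eq)
    moreover have "emeasure (distr lborel borel ?C) (box l u) = emeasure lborel (?C -` box l u)"
      by (subst emeasure_distr) (auto simp: C_meas)
    ultimately show "emeasure (distr lborel borel ?C) (box l u) = ennreal (\<Prod>b\<in>Basis. (u - l) \<bullet> b)"
      by (simp add: Basis_complex_def)
  qed simp
  then have "(\<integral>\<^sup>+z. f z \<partial>lborel) = (\<integral>\<^sup>+z. f z \<partial>distr (lborel :: (real \<times> real) measure) borel ?C)"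
    by simp
  also have "\<dots> = (\<integral>\<^sup>+p. f (?C p) \<partial>(lborel \<Otimes>\<^sub>M lborel))"
    by (simp add: nn_integral_distr lborel_prod)
  also have "\<dots> = (\<integral>\<^sup>+x. \<integral>\<^sup>+y. f (Complex x y) \<partial>lborel \<partial>lborel)"
    by (subst lborel.nn_integral_fst[symmetric]) (auto simp: lborel_prod)
  finally show ?thesis .
qed

text \<open>Multiplication by \<open>l\<close> acts on the plane as a real 2 by 2 matrix. If \<open>Re l \<noteq> 0\<close>, Gaussian elimination splits this matrix into two maps that each change
a single coordinate by an affine substitution, with slopes \<open>Re l\<close> and \<open>(cmod l)\<^sup>2 / Re l\<close>. If
\<open>Re l = 0\<close>, the factorisation \<open>l = (1 + \<i>) * (l / (1 + \<i>))\<close> has both factors with nonzero real part.\<close>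
lemma nn_integral_complex_affine:
  fixes f :: "complex \<Rightarrow> ennreal"
  assumes [measurable]: "f \<in> borel_measurable borel" and "l \<noteq> 0"
  shows "(\<integral>\<^sup>+z. f z \<partial>lborel) = ennreal ((cmod l)\<^sup>2) * (\<integral>\<^sup>+z. f (b + l * z) \<partial>lborel)"
proof -
  have shear: "(\<integral>\<^sup>+z. f z \<partial>lborel) = ennreal ((cmod l)\<^sup>2) * (\<integral>\<^sup>+z. f (b + l * z) \<partial>lborel)"
    if [measurable]: "f \<in> borel_measurable borel" and a: "Re l \<noteq> 0"
    for f :: "complex \<Rightarrow> ennreal" and b l
  proof -
    define a e p q where "a = Re l" and "e = Im l" and "p = Re b" and "q = Im b"
    note defs = a_def e_def p_def q_def
    \<comment> \<open>With \<open>u\<close> the new real part, the new imaginary part is \<open>s u + k * y\<close>.\<close>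
    define k where "k = (a\<^sup>2 + e\<^sup>2) / a"
    define s where "s = (\<lambda>u. q + e * (u - p) / a)"
    have a0: "a \<noteq> 0" and k0: "k \<noteq> 0"
      using a by (auto simp: a_def k_def sum_power2_eq_zero_iff)
    have point: "b + l * Complex x y = Complex (p - e * y + a * x) (s (p - e * y + a * x) + k * y)" for x y
      using a0 by (simp add: complex_eq_iff defs s_def k_def field_simps power2_eq_square)
    have "ennreal \<bar>a\<bar> * (\<integral>\<^sup>+z. f (b + l * z) \<partial>lborel)
        = ennreal \<bar>a\<bar> * (\<integral>\<^sup>+y. \<integral>\<^sup>+x. f (b + l * Complex x y) \<partial>lborel \<partial>lborel)"
      by (subst nn_integral_lborel_complex, measurable) (subst lborel_pair.Fubini', auto)
    also have "\<dots> = (\<integral>\<^sup>+y. \<integral>\<^sup>+u. f (Complex u (s u + k * y)) \<partial>lborel \<partial>lborel)"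
      unfolding point s_def
      by (subst nn_integral_cmult[symmetric], measurable, rule nn_integral_cong,
          rule nn_integral_real_affine[symmetric], use a0 in auto)
    also have "\<dots> = (\<integral>\<^sup>+u. \<integral>\<^sup>+y. f (Complex u (s u + k * y)) \<partial>lborel \<partial>lborel)"
      unfolding s_def by (subst lborel_pair.Fubini') auto
    finally have "ennreal \<bar>k\<bar> * (ennreal \<bar>a\<bar> * (\<integral>\<^sup>+z. f (b + l * z) \<partial>lborel))
        = (\<integral>\<^sup>+u. ennreal \<bar>k\<bar> * (\<integral>\<^sup>+y. f (Complex u (s u + k * y)) \<partial>lborel) \<partial>lborel)"
      by (subst nn_integral_cmult) (auto simp: s_def)
    also have "\<dots> = (\<integral>\<^sup>+u. \<integral>\<^sup>+v. f (Complex u v) \<partial>lborel \<partial>lborel)"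
      by (intro nn_integral_cong nn_integral_real_affine[symmetric]) (use k0 in auto)
    also have "\<dots> = (\<integral>\<^sup>+z. f z \<partial>lborel)"
      by (rule nn_integral_lborel_complex[symmetric]) simp
    also have "ennreal \<bar>k\<bar> * (ennreal \<bar>a\<bar> * (\<integral>\<^sup>+z. f (b + l * z) \<partial>lborel))
        = ennreal (\<bar>k\<bar> * \<bar>a\<bar>) * (\<integral>\<^sup>+z. f (b + l * z) \<partial>lborel)"
      by (simp add: ennreal_mult mult.assoc)
    also have "\<bar>k\<bar> * \<bar>a\<bar> = (cmod l)\<^sup>2"
      using a0 by (simp add: k_def cmod_power2 defs abs_mult[symmetric] abs_of_nonneg)
    finally show ?thesis ..
  qed
  show ?thesis
  proof (cases "Re l = 0")
    case True
    define l' where "l' = l / (1 + \<i>)"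
    have nz: "1 + \<i> \<noteq> 0"
      by (simp add: complex_eq_iff)
    have l: "l = (1 + \<i>) * l'"
      using nz by (simp add: l'_def)
    have "Re l' = Im l / 2"
      using True by (simp add: l'_def Re_divide power2_eq_square)
    then have "Re l' \<noteq> 0"
      using True \<open>l \<noteq> 0\<close> by (auto simp: complex_eq_iff)
    have "(\<integral>\<^sup>+z. f z \<partial>lborel)
        = ennreal ((cmod (1 + \<i>))\<^sup>2) * (\<integral>\<^sup>+z. f (b + (1 + \<i>) * z) \<partial>lborel)"
      by (rule shear) auto
    also have "(\<integral>\<^sup>+z. f (b + (1 + \<i>) * z) \<partial>lborel)
        = ennreal ((cmod l')\<^sup>2) * (\<integral>\<^sup>+z. f (b + (1 + \<i>) * (0 + l' * z)) \<partial>lborel)"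
      using \<open>Re l' \<noteq> 0\<close> by (intro shear) auto
    finally show ?thesis
      by (simp add: l norm_mult power_mult_distrib ennreal_mult mult.assoc)
  qed (rule shear, auto)
qed

section \<open>Mean value inequalities for entire functions\<close>

text \<open>Cauchy's formula on the unit circle is applied to the square of \<open>\<lambda>w. f (p + w * z)\<close>, which is again
entire. Squaring before taking absolute values gives the mean value inequality for the square of
the modulus without a Cauchy-Schwarz step.\<close>
lemma circle_mean_square:
  assumes "f holomorphic_on UNIV"
  shows "ennreal ((cmod (f p))\<^sup>2)
    \<le> (\<integral>\<^sup>+t. ennreal ((cmod (f (p + cis (2 * pi * t) * z)))\<^sup>2) * indicator {0..1} t \<partial>lborel)"
proof -
  define h where "h = (\<lambda>w. (f (p + w * z))\<^sup>2)"
  have f_comp: "(\<lambda>w. f (g w)) holomorphic_on A" if "g holomorphic_on A" for g A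
    using holomorphic_on_compose[OF that, of f] assms holomorphic_on_subset
    by (auto simp: o_def)
  have hol: "h holomorphic_on A" for A
    unfolding h_def by (intro holomorphic_intros f_comp)
  have path: "circlepath 0 1 t = cis (2 * pi * t)" for t
    by (simp add: circlepath cis_conv_exp mult_ac)
  have "((\<lambda>u. h u / (u - 0)) has_contour_integral (2 * of_real pi * \<i>) * h 0) (circlepath 0 1)"
    by (rule Cauchy_integral_circlepath_simple) (auto intro: hol)
  then have "((\<lambda>t. 2 * of_real pi * \<i> * h (cis (2 * pi * t))) has_integral
      (2 * of_real pi * \<i>) * h 0) {0..1}"
    unfolding has_contour_integral_def
    by (rule has_integral_eq[rotated])
       (auto simp: path vector_derivative_circlepath01 cis_conv_exp mult_ac)
  then have "((\<lambda>t. 1 / (2 * of_real pi * \<i>) * (2 * of_real pi * \<i> * h (cis (2 * pi * t))))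
      has_integral 1 / (2 * of_real pi * \<i>) * ((2 * of_real pi * \<i>) * h 0)) {0..1}"
    by (rule has_integral_mult_right)
  then have int: "((\<lambda>t. h (cis (2 * pi * t))) has_integral h 0) {0..1}"
    by simp
  have cont: "continuous_on {0..1} (\<lambda>t. h (cis (2 * pi * t)))"
    by (rule continuous_on_compose2[OF holomorphic_on_imp_continuous_on[OF hol[of UNIV]]])
       (auto intro!: continuous_intros)
  then have "(\<lambda>t. cmod (h (cis (2 * pi * t)))) integrable_on {0..1}"
    by (intro integrable_continuous_interval continuous_intros)
  then obtain I where I: "((\<lambda>t. cmod (h (cis (2 * pi * t)))) has_integral I) {0..1}"
    by blast
  have "cmod (h 0) \<le> I"
    using integral_norm_bound_integral[OF has_integral_integrable[OF int] has_integral_integrable[OF I]]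
      integral_unique[OF int] integral_unique[OF I] by simp
  then have "ennreal ((cmod (f p))\<^sup>2) \<le> ennreal I"
    by (simp add: h_def norm_power ennreal_leI)
  also have "ennreal I = (\<integral>\<^sup>+t. ennreal (cmod (h (cis (2 * pi * t)))) * indicator {0..1} t \<partial>lborel)"
    by (rule nn_integral_has_integral_lebesgue'[OF _ I, symmetric]) auto
  finally show ?thesis
    by (simp add: h_def norm_power)
qed

lemma holomorphic_borel:
  assumes "f holomorphic_on UNIV"
  shows "f \<in> borel_measurable borel"
  using assms by (intro borel_measurable_continuous_onI holomorphic_on_imp_continuous_on)

text \<open>Averaging the inequality on circles over all \<open>z\<close> in the unit disc and exchanging the integrals
leaves, for each angle, an integral over a rotated disc, and rotations preserve Lebesgue measure. In
this way the area mean value inequality is obtained without polar coordinates.\<close>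
lemma ball_mean_square:
  assumes "f holomorphic_on UNIV"
  shows "ennreal ((cmod (f p))\<^sup>2) * emeasure lborel (ball (0::complex) 1)
    \<le> (\<integral>\<^sup>+z. ennreal ((cmod (f (p + z)))\<^sup>2) * indicator (ball 0 1) z \<partial>lborel)"
proof -
  note [measurable] = holomorphic_borel[OF assms]
  let ?F = "\<lambda>z. ennreal ((cmod (f (p + z)))\<^sup>2)"
  let ?I = "indicator {0..1} :: real \<Rightarrow> ennreal"
  define B where "B = (indicator (ball 0 1) :: complex \<Rightarrow> ennreal)"
  have [measurable]: "B \<in> borel_measurable borel"
    unfolding B_def by (rule borel_measurable_indicator) simp
  define u where "u = (\<lambda>t. cis (2 * pi * t))"
  have [measurable]: "u \<in> borel_measurable borel"
    unfolding u_def by (intro borel_measurable_continuous_onI continuous_intros)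
  have "ennreal ((cmod (f p))\<^sup>2) * emeasure lborel (ball (0::complex) 1)
      = (\<integral>\<^sup>+z. ennreal ((cmod (f p))\<^sup>2) * B z \<partial>lborel)"
    by (simp add: B_def nn_integral_cmult_indicator)
  also have "\<dots> \<le> (\<integral>\<^sup>+z. (\<integral>\<^sup>+t. ?F (u t * z) * ?I t \<partial>lborel) * B z \<partial>lborel)"
    unfolding u_def by (intro nn_integral_mono mult_right_mono circle_mean_square assms) auto
  also have "\<dots> = (\<integral>\<^sup>+z. \<integral>\<^sup>+t. ?F (u t * z) * ?I t * B z \<partial>lborel \<partial>lborel)"
    by (intro nn_integral_cong nn_integral_multc[symmetric]) measurable
  also have "\<dots> = (\<integral>\<^sup>+t. \<integral>\<^sup>+z. ?F (u t * z) * ?I t * B z \<partial>lborel \<partial>lborel)"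
    by (subst lborel_pair.Fubini') auto
  also have "\<dots> = (\<integral>\<^sup>+t. (\<integral>\<^sup>+z. ?F z * B z \<partial>lborel) * ?I t \<partial>lborel)"
  proof (rule nn_integral_cong)
    fix t :: real
    have "(\<integral>\<^sup>+z. ?F z * B z \<partial>lborel)
        = (\<integral>\<^sup>+z. ?F (u t * z) * B (u t * z) \<partial>lborel)"
      by (subst nn_integral_complex_affine[of _ "u t" 0]) (auto simp: u_def)
    also have "\<dots> = (\<integral>\<^sup>+z. ?F (u t * z) * B z \<partial>lborel)"
      by (intro nn_integral_cong) (auto simp: B_def indicator_def norm_mult u_def)
    finally show "(\<integral>\<^sup>+z. ?F (u t * z) * ?I t * B z \<partial>lborel)
        = (\<integral>\<^sup>+z. ?F z * B z \<partial>lborel) * ?I t"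
      by (cases "t \<in> {0..1}") simp_all
  qed
  also have "\<dots> = (\<integral>\<^sup>+z. ?F z * B z \<partial>lborel)"
    by (subst nn_integral_cmult) auto
  finally show ?thesis unfolding B_def .
qed

section \<open>An integrable majorant on the plane\<close>

lemma integrable_inverse_1_plus_square_UNIV:
  "integrable lborel (\<lambda>x::real. inverse (1 + x\<^sup>2))"
  using integrable_inverse_1_plus_square by (simp add: set_integrable_def)

lemma nn_integral_product_cauchy_finite:
  "(\<integral>\<^sup>+z. ennreal (inverse ((1 + (Re z)\<^sup>2) * (1 + (Im z)\<^sup>2))) \<partial>lborel) < \<infinity>"
proof -
  let ?A = "\<integral>\<^sup>+x. ennreal (inverse (1 + x\<^sup>2)) \<partial>lborel"
  have "(\<integral>\<^sup>+z. ennreal (inverse ((1 + (Re z)\<^sup>2) * (1 + (Im z)\<^sup>2))) \<partial>lborel)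
      = (\<integral>\<^sup>+x. \<integral>\<^sup>+y. ennreal (inverse (1 + x\<^sup>2)) * ennreal (inverse (1 + y\<^sup>2)) \<partial>lborel \<partial>lborel)"
    by (subst nn_integral_lborel_complex) (auto simp: ennreal_mult[symmetric] mult_ac)
  also have "\<dots> = ?A * ?A"
    by (simp add: nn_integral_cmult nn_integral_multc)
  also have "\<dots> < \<infinity>"
  proof -
    have "?A < \<infinity>"
      using integrable_inverse_1_plus_square_UNIV
      by (subst (asm) integrable_iff_bounded) auto
    then show ?thesis
      by (simp add: ennreal_mult_less_top)
  qed
  finally show ?thesis .
qed

text \<open>The factor \<open>(1 + t\<^sup>2)\<^sup>2\<close> is the room left for comparing with the integrable function
\<open>1 / ((1 + x\<^sup>2) * (1 + y\<^sup>2))\<close> on the plane.\<close>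
lemma polynomial_times_exp_powr_bounded:
  fixes a m :: real
  assumes "a > 0" "m > 0"
  obtains M where "M \<ge> 0" "\<And>t. t \<ge> 0 \<Longrightarrow> t ^ k * (1 + t\<^sup>2)\<^sup>2 * exp (- a * t powr m) \<le> M"
proof -
  have "((\<lambda>t::real. t ^ k * (1 + t\<^sup>2)\<^sup>2 * exp (- a * t powr m)) \<longlongrightarrow> 0) at_top"
    using assms by real_asymp
  then have "eventually (\<lambda>t. t ^ k * (1 + t\<^sup>2)\<^sup>2 * exp (- a * t powr m) < 1) at_top"
    by (rule order_tendstoD) simp
  then obtain R where R: "t ^ k * (1 + t\<^sup>2)\<^sup>2 * exp (- a * t powr m) < 1" if "t \<ge> R" for t
    by (auto simp: eventually_at_top_linorder)
  define M where "M = max 1 (R ^ k * (1 + R\<^sup>2)\<^sup>2)"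
  show ?thesis
  proof
    show "M \<ge> 0" by (simp add: M_def)
    fix t :: real assume t: "t \<ge> 0"
    show "t ^ k * (1 + t\<^sup>2)\<^sup>2 * exp (- a * t powr m) \<le> M"
    proof (cases "t \<ge> R")
      case True
      then show ?thesis using R[of t] by (simp add: M_def)
    next
      case False
      have "t ^ k * (1 + t\<^sup>2)\<^sup>2 * exp (- a * t powr m) \<le> R ^ k * (1 + R\<^sup>2)\<^sup>2 * 1"
        using False t assms by (intro mult_mono power_mono add_mono) auto
      then show ?thesis by (simp add: M_def)
    qed
  qed
qed

section \<open>Energy and boundedness in Fock spaces\<close>

definition fock_const :: "real \<Rightarrow> real \<Rightarrow> real" where
  "fock_const \<alpha> m = m * \<alpha> powr (2 / m) / (2 * pi * Gamma (2 / m))"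

text \<open>The squared norm, with values in the extended nonnegative reals: there it also says, by being
finite, which entire functions belong to the space, and inequalities need no integrability
hypotheses.\<close>
definition fock_energy :: "real \<Rightarrow> real \<Rightarrow> (complex \<Rightarrow> complex) \<Rightarrow> ennreal" where
  "fock_energy \<alpha> m f = (\<integral>\<^sup>+z. ennreal ((cmod (f z))\<^sup>2) \<partial>fock_measure \<alpha> m)"

lemma fock_const_pos: "\<alpha> > 0 \<Longrightarrow> m > 0 \<Longrightarrow> fock_const \<alpha> m > 0"
  by (simp add: fock_const_def Gamma_real_pos)

lemma sets_fock_measure [measurable_cong]: "sets (fock_measure \<alpha> m) = sets borel"
  by (simp add: fock_measure_def)

lemma fock_energy_lborel:
  assumes "\<alpha> > 0" "m > 0" and [measurable]: "f \<in> borel_measurable borel"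
  shows "fock_energy \<alpha> m f = ennreal (fock_const \<alpha> m) *
    (\<integral>\<^sup>+z. ennreal (exp (- \<alpha> * cmod z powr m) * (cmod (f z))\<^sup>2) \<partial>lborel)"
proof -
  have "fock_energy \<alpha> m f = (\<integral>\<^sup>+z. ennreal (fock_const \<alpha> m * exp (- \<alpha> * cmod z powr m))
      * ennreal ((cmod (f z))\<^sup>2) \<partial>lborel)"
    unfolding fock_energy_def fock_measure_def fock_const_def[symmetric]
    by (rule nn_integral_density) measurable
  also have "\<dots> = (\<integral>\<^sup>+z. ennreal (fock_const \<alpha> m) *
      ennreal (exp (- \<alpha> * cmod z powr m) * (cmod (f z))\<^sup>2) \<partial>lborel)"
    using fock_const_pos[OF assms(1,2)]
    by (intro nn_integral_cong) (simp add: ennreal_mult[symmetric] mult.assoc)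
  finally show ?thesis
    by (simp add: nn_integral_cmult)
qed

lemma fock_space_iff_energy:
  "f \<in> fock_space \<alpha> m \<longleftrightarrow> f holomorphic_on UNIV \<and> fock_energy \<alpha> m f < \<infinity>"
proof (cases "f holomorphic_on UNIV")
  case True
  note [measurable] = holomorphic_borel[OF True]
  show ?thesis
    using True by (simp add: fock_space_def fock_energy_def integrable_iff_bounded)
qed (simp add: fock_space_def)

lemma fock_norm_nonneg_square:
  assumes "f \<in> fock_space \<alpha> m"
  shows "fock_norm \<alpha> m f \<ge> 0" "ennreal ((fock_norm \<alpha> m f)\<^sup>2) = fock_energy \<alpha> m f"
proof -
  have "fock_inner \<alpha> m f f = of_real (LINT z|fock_measure \<alpha> m. (cmod (f z))\<^sup>2)"
    unfolding fock_inner_def complex_norm_square[symmetric] of_real_power[symmetric]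
    by (rule integral_complex_of_real)
  then have norm: "fock_norm \<alpha> m f = sqrt (LINT z|fock_measure \<alpha> m. (cmod (f z))\<^sup>2)"
    by (simp add: fock_norm_def)
  show "fock_norm \<alpha> m f \<ge> 0"
    by (simp add: norm)
  show "ennreal ((fock_norm \<alpha> m f)\<^sup>2) = fock_energy \<alpha> m f"
    using assms unfolding norm fock_energy_def fock_space_def
    by (subst nn_integral_eq_integral) auto
qed

lemma weighted_comp_holomorphic:
  assumes "\<psi> holomorphic_on UNIV" "\<phi> holomorphic_on UNIV" "f holomorphic_on UNIV"
  shows "weighted_comp \<psi> \<phi> f holomorphic_on UNIV"
  unfolding weighted_comp_def
  by (intro holomorphic_intros assms holomorphic_on_compose holomorphic_on_subset[OF assms(3)]) auto

lemma fock_bounded_weighted_compI: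
  assumes "\<psi> holomorphic_on UNIV" "\<phi> holomorphic_on UNIV" "K \<ge> 0"
    and energy: "\<And>f. f \<in> fock_space \<alpha> m \<Longrightarrow>
      fock_energy \<alpha> m (weighted_comp \<psi> \<phi> f) \<le> ennreal K * fock_energy \<alpha> m f"
  shows "fock_bounded \<alpha> m (weighted_comp \<psi> \<phi>)"
proof -
  let ?T = "weighted_comp \<psi> \<phi>"
  have maps: "?T f \<in> fock_space \<alpha> m" if "f \<in> fock_space \<alpha> m" for f
  proof -
    have "ennreal K * fock_energy \<alpha> m f < \<infinity>"
      using that by (simp add: fock_space_iff_energy ennreal_mult_less_top)
    with energy[OF that] weighted_comp_holomorphic[OF assms(1,2)] that show ?thesis
      by (auto simp: fock_space_iff_energy)
  qed
  have "fock_norm \<alpha> m (?T f) \<le> sqrt K * fock_norm \<alpha> m f" if f: "f \<in> fock_space \<alpha> m" for f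
  proof -
    have "ennreal ((fock_norm \<alpha> m (?T f))\<^sup>2) \<le> ennreal (K * (fock_norm \<alpha> m f)\<^sup>2)"
      using energy[OF f] fock_norm_nonneg_square[OF f] fock_norm_nonneg_square[OF maps[OF f]] \<open>K \<ge> 0\<close>
      by (simp add: ennreal_mult)
    then have "(fock_norm \<alpha> m (?T f))\<^sup>2 \<le> K * (fock_norm \<alpha> m f)\<^sup>2"
      using \<open>K \<ge> 0\<close> by (simp add: ennreal_le_iff)
    then have "sqrt ((fock_norm \<alpha> m (?T f))\<^sup>2) \<le> sqrt (K * (fock_norm \<alpha> m f)\<^sup>2)"
      by (rule real_sqrt_le_mono)
    then show ?thesis
      using fock_norm_nonneg_square(1)[OF f] fock_norm_nonneg_square(1)[OF maps[OF f]]
      by (simp add: real_sqrt_mult)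
  qed
  then show ?thesis
    unfolding fock_bounded_def
  proof (intro conjI ballI allI exI[of _ "sqrt K"])
    show "?T (\<lambda>z. a * f z + b * g z) = (\<lambda>z. a * ?T f z + b * ?T g z)" for f g a b
      by (simp add: weighted_comp_def algebra_simps)
  qed (auto simp: maps)
qed

lemma fock_boundedD:
  assumes "fock_bounded \<alpha> m T"
  obtains K where "K \<ge> 0"
    "\<And>f. f \<in> fock_space \<alpha> m \<Longrightarrow> fock_energy \<alpha> m (T f) \<le> ennreal K * fock_energy \<alpha> m f"
proof -
  from assms obtain C where maps: "\<And>f. f \<in> fock_space \<alpha> m \<Longrightarrow> T f \<in> fock_space \<alpha> m"
    and C: "\<And>f. f \<in> fock_space \<alpha> m \<Longrightarrow> fock_norm \<alpha> m (T f) \<le> C * fock_norm \<alpha> m f"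
    unfolding fock_bounded_def by blast
  show ?thesis
  proof
    show "C\<^sup>2 \<ge> 0" by simp
    fix f assume f: "f \<in> fock_space \<alpha> m"
    have "(fock_norm \<alpha> m (T f))\<^sup>2 \<le> C\<^sup>2 * (fock_norm \<alpha> m f)\<^sup>2"
      using power_mono[OF C[OF f] fock_norm_nonneg_square(1)[OF maps[OF f]], of 2]
      by (simp add: power_mult_distrib)
    then have "ennreal ((fock_norm \<alpha> m (T f))\<^sup>2) \<le> ennreal (C\<^sup>2 * (fock_norm \<alpha> m f)\<^sup>2)"
      by (rule ennreal_leI)
    then show "fock_energy \<alpha> m (T f) \<le> ennreal (C\<^sup>2) * fock_energy \<alpha> m f"
      by (simp add: ennreal_mult fock_norm_nonneg_square(2)[OF f] fock_norm_nonneg_square(2)[OF maps[OF f]])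
  qed
qed

section \<open>Monomials, affine substitutions and point evaluations\<close>

text \<open>Besides the test functions for the necessity of \<open>cmod l \<le> 1\<close>, this provides (for \<open>n = 0\<close>) the
finiteness of the total mass.\<close>
lemma monomial_in_fock_space:
  assumes "\<alpha> > 0" "m > 0"
  shows "(\<lambda>z. z ^ n) \<in> fock_space \<alpha> m"
proof -
  obtain M where M: "M \<ge> 0"
    "\<And>t. t \<ge> 0 \<Longrightarrow> t ^ (2 * n) * (1 + t\<^sup>2)\<^sup>2 * exp (- \<alpha> * t powr m) \<le> M"
    using polynomial_times_exp_powr_bounded[OF assms] by blast
  have bound: "exp (- \<alpha> * cmod z powr m) * (cmod (z ^ n))\<^sup>2
      \<le> M * inverse ((1 + (Re z)\<^sup>2) * (1 + (Im z)\<^sup>2))" for z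
  proof -
    have "(1 + (Re z)\<^sup>2) * (1 + (Im z)\<^sup>2) \<le> (1 + (cmod z)\<^sup>2)\<^sup>2"
      unfolding cmod_power2 power2_eq_square[of "1 + ((Re z)\<^sup>2 + (Im z)\<^sup>2)"]
      by (intro mult_mono) auto
    then have "exp (- \<alpha> * cmod z powr m) * (cmod (z ^ n))\<^sup>2 * ((1 + (Re z)\<^sup>2) * (1 + (Im z)\<^sup>2))
        \<le> exp (- \<alpha> * cmod z powr m) * (cmod (z ^ n))\<^sup>2 * (1 + (cmod z)\<^sup>2)\<^sup>2"
      by (intro mult_left_mono) auto
    also have "\<dots> \<le> M"
      using M(2)[of "cmod z"] by (simp add: norm_power power_mult[symmetric] mult_ac)
    finally show ?thesis
      by (simp add: field_simps add_pos_nonneg)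
  qed
  have "(\<integral>\<^sup>+z. ennreal (exp (- \<alpha> * cmod z powr m) * (cmod (z ^ n))\<^sup>2) \<partial>lborel)
      \<le> (\<integral>\<^sup>+z. ennreal M * ennreal (inverse ((1 + (Re z)\<^sup>2) * (1 + (Im z)\<^sup>2))) \<partial>lborel)"
    using bound M(1) by (intro nn_integral_mono) (simp add: ennreal_mult[symmetric] ennreal_leI)
  also have "\<dots> = ennreal M * (\<integral>\<^sup>+z. ennreal (inverse ((1 + (Re z)\<^sup>2) * (1 + (Im z)\<^sup>2))) \<partial>lborel)"
    by (rule nn_integral_cmult) measurable
  also have "\<dots> < \<infinity>"
    using nn_integral_product_cauchy_finite by (simp add: ennreal_mult_less_top)
  finally show ?thesis
    using assms by (simp add: fock_space_iff_energy fock_energy_lborel ennreal_mult_less_top holomorphic_intros)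
qed

lemma fock_energy_cmult:
  assumes "f holomorphic_on UNIV"
  shows "fock_energy \<alpha> m (\<lambda>z. c * f z) = ennreal ((cmod c)\<^sup>2) * fock_energy \<alpha> m f"
proof -
  note [measurable] = holomorphic_borel[OF assms]
  show ?thesis
    unfolding fock_energy_def
    by (subst nn_integral_cmult[symmetric]) (auto simp: norm_mult power_mult_distrib ennreal_mult)
qed

text \<open>The substitution \<open>w = b + l * z\<close> turns the energy on the left into an integral of
\<open>(cmod (f w))\<^sup>2\<close> against a transformed weight, so a pointwise comparison of weights suffices.\<close>
lemma fock_energy_affine_le:
  assumes "\<alpha> > 0" "m > 0" "l \<noteq> 0" "K \<ge> 0"
    and "\<psi> holomorphic_on UNIV" "f holomorphic_on UNIV"
    and weight: "\<And>z. (cmod (\<psi> z))\<^sup>2 * exp (- \<alpha> * cmod z powr m)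
      \<le> K * exp (- \<alpha> * cmod (b + l * z) powr m)"
  shows "fock_energy \<alpha> m (\<lambda>z. \<psi> z * f (b + l * z)) \<le> ennreal (K / (cmod l)\<^sup>2) * fock_energy \<alpha> m f"
proof -
  note [measurable] = holomorphic_borel[OF assms(5)] holomorphic_borel[OF assms(6)]
  define g where "g = (\<lambda>w. ennreal (exp (- \<alpha> * cmod w powr m) * (cmod (f w))\<^sup>2))"
  have g [measurable]: "g \<in> borel_measurable borel"
    unfolding g_def by measurable
  have "(\<integral>\<^sup>+z. ennreal (exp (- \<alpha> * cmod z powr m) * (cmod (\<psi> z * f (b + l * z)))\<^sup>2) \<partial>lborel)
      \<le> (\<integral>\<^sup>+z. ennreal K * g (b + l * z) \<partial>lborel)"
  proof (rule nn_integral_mono)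
    fix z
    have "exp (- \<alpha> * cmod z powr m) * (cmod (\<psi> z * f (b + l * z)))\<^sup>2
        = ((cmod (\<psi> z))\<^sup>2 * exp (- \<alpha> * cmod z powr m)) * (cmod (f (b + l * z)))\<^sup>2"
      by (simp add: norm_mult power_mult_distrib)
    also have "\<dots> \<le> (K * exp (- \<alpha> * cmod (b + l * z) powr m)) * (cmod (f (b + l * z)))\<^sup>2"
      by (intro mult_right_mono weight) auto
    finally show "ennreal (exp (- \<alpha> * cmod z powr m) * (cmod (\<psi> z * f (b + l * z)))\<^sup>2)
        \<le> ennreal K * g (b + l * z)"
      using \<open>K \<ge> 0\<close> by (simp add: g_def ennreal_mult[symmetric] ennreal_leI mult.assoc)
  qed
  also have "\<dots> = ennreal K * (\<integral>\<^sup>+z. g (b + l * z) \<partial>lborel)"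
    by (rule nn_integral_cmult) measurable
  also have "\<dots> = ennreal (K / (cmod l)\<^sup>2) * (\<integral>\<^sup>+w. g w \<partial>lborel)"
    using assms(3,4)
    by (subst nn_integral_complex_affine[OF g, of l b])
       (simp_all add: mult.assoc[symmetric] ennreal_mult[symmetric])
  finally have "(\<integral>\<^sup>+z. ennreal (exp (- \<alpha> * cmod z powr m) * (cmod (\<psi> z * f (b + l * z)))\<^sup>2) \<partial>lborel)
      \<le> ennreal (K / (cmod l)\<^sup>2) * (\<integral>\<^sup>+w. g w \<partial>lborel)" .
  then show ?thesis
    using assms(1,2) unfolding g_def
    by (subst (1 2) fock_energy_lborel) (auto simp: mult.left_commute intro!: mult_left_mono)
qed

text \<open>On the unit disc around \<open>p\<close> the density of the Fock measure is at least a constant times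
\<open>exp (- \<alpha> * (cmod p + 1) powr m)\<close>, so the area mean value inequality bounds \<open>f p\<close> by the norm. The
explicit dependence on \<open>p\<close> limits the growth of the members of the space; for one fixed \<open>p\<close> the
bound is the continuity of point evaluation.\<close>
lemma point_evaluation_bound:
  assumes "\<alpha> > 0" "m > 0"
  obtains K where "K \<ge> 0" "\<And>f p. f holomorphic_on UNIV \<Longrightarrow>
    ennreal ((cmod (f p))\<^sup>2) \<le> ennreal (K * exp (\<alpha> * (cmod p + 1) powr m)) * fock_energy \<alpha> m f"
proof -
  define v where "v = measure lborel (ball (0::complex) 1)"
  have "emeasure lborel (ball (0::complex) 1) \<noteq> \<infinity>"
    using emeasure_lborel_ball_finite[of "0::complex" 1] by simp
  then have v: "v > 0" "emeasure lborel (ball (0::complex) 1) = ennreal v"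
    using content_ball_pos[of 1 "0::complex"] unfolding v_def
    by (simp_all add: emeasure_eq_ennreal_measure)
  note k = fock_const_pos[OF assms]
  show ?thesis
  proof
    show "1 / (v * fock_const \<alpha> m) \<ge> 0"
      using v k by simp
    fix f :: "complex \<Rightarrow> complex" and p
    assume f: "f holomorphic_on UNIV"
    note [measurable] = holomorphic_borel[OF f]
    define E where "E = exp (\<alpha> * (cmod p + 1) powr m)"
    let ?J = "\<integral>\<^sup>+z. ennreal (exp (- \<alpha> * cmod z powr m) * (cmod (f z))\<^sup>2) \<partial>lborel"
    have "ennreal ((cmod (f p))\<^sup>2) * ennreal v
        \<le> (\<integral>\<^sup>+z. ennreal ((cmod (f (p + z)))\<^sup>2) * indicator (ball 0 1) z \<partial>lborel)"
      using ball_mean_square[OF f, of p] v by simp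
    also have "\<dots> \<le> (\<integral>\<^sup>+z. ennreal E *
        ennreal (exp (- \<alpha> * cmod (p + 1 * z) powr m) * (cmod (f (p + 1 * z)))\<^sup>2) \<partial>lborel)"
    proof (rule nn_integral_mono)
      fix z :: complex
      show "ennreal ((cmod (f (p + z)))\<^sup>2) * indicator (ball 0 1) z
          \<le> ennreal E * ennreal (exp (- \<alpha> * cmod (p + 1 * z) powr m) * (cmod (f (p + 1 * z)))\<^sup>2)"
      proof (cases "z \<in> ball 0 1")
        case True
        then have "cmod (p + z) \<le> cmod p + 1"
          using norm_triangle_ineq[of p z] by simp
        then have "cmod (p + z) powr m \<le> (cmod p + 1) powr m"
          using assms by (intro powr_mono2) auto
        then have "1 \<le> E * exp (- \<alpha> * cmod (p + z) powr m)"
          using assms by (simp add: E_def exp_add[symmetric])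
        then have "1 * (cmod (f (p + z)))\<^sup>2 \<le> E * exp (- \<alpha> * cmod (p + z) powr m) * (cmod (f (p + z)))\<^sup>2"
          by (intro mult_right_mono) auto
        then show ?thesis
          using True by (simp add: ennreal_mult[symmetric] E_def mult.assoc ennreal_leI)
      qed simp
    qed
    also have "\<dots> = ennreal E * ?J"
      by (subst nn_integral_cmult, measurable) (subst (2) nn_integral_complex_affine[of _ 1 p], auto)
    finally have *: "ennreal ((cmod (f p))\<^sup>2) * ennreal v \<le> ennreal E * ?J" .
    have "ennreal ((cmod (f p))\<^sup>2) = ennreal (1 / v) * (ennreal ((cmod (f p))\<^sup>2) * ennreal v)"
      using v by (simp add: ennreal_mult[symmetric])
    also have "\<dots> \<le> ennreal (1 / v) * (ennreal E * ?J)"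
      by (intro mult_left_mono *) auto
    also have "\<dots> = ennreal (1 / (v * fock_const \<alpha> m) * E) * (ennreal (fock_const \<alpha> m) * ?J)"
      using v k by (simp add: ennreal_mult[symmetric] mult.assoc[symmetric] E_def)
    also have "\<dots> = ennreal (1 / (v * fock_const \<alpha> m) * E) * fock_energy \<alpha> m f"
      using assms by (simp add: fock_energy_lborel)
    finally show "ennreal ((cmod (f p))\<^sup>2)
        \<le> ennreal (1 / (v * fock_const \<alpha> m) * exp (\<alpha> * (cmod p + 1) powr m)) * fock_energy \<alpha> m f"
      by (simp add: E_def)
  qed
qed

section \<open>Comparison of weights under affine maps\<close>

text \<open>For \<open>s = x + y\<close> the fractions \<open>x / s\<close> and \<open>y / s\<close> lie in the unit interval, where a power with exponent at
most one dominates the identity; the two fractions add up to one.\<close>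
lemma add_powr_le_powr_add_powr:
  fixes x y m :: real
  assumes "0 < m" "m \<le> 1" "0 \<le> x" "0 \<le> y"
  shows "(x + y) powr m \<le> x powr m + y powr m"
proof (cases "x + y = 0")
  case False
  define s where "s = x + y"
  have s: "s > 0" using False assms by (simp add: s_def)
  have part: "s powr m * (w / s) \<le> w powr m" if "0 \<le> w" "w \<le> s" for w
  proof (cases "w = 0")
    case False
    have "w / s = (w / s) powr 1"
      using that s by simp
    also have "\<dots> \<le> (w / s) powr m"
      using that s assms False by (intro powr_mono') auto
    finally have "s powr m * (w / s) \<le> s powr m * (w / s) powr m"
      by (intro mult_left_mono) auto
    also have "\<dots> = w powr m"
      using that s by (simp add: powr_mult[symmetric])
    finally show ?thesis .
  qed simp
  have "(x + y) powr m = s powr m * (x / s) + s powr m * (y / s)"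
    using s by (simp add: s_def add_divide_distrib[symmetric] distrib_left[symmetric])
  also have "\<dots> \<le> x powr m + y powr m"
    using assms by (intro add_mono part) (auto simp: s_def)
  finally show ?thesis .
qed (use assms in auto)

text \<open>Subadditivity of \<open>t powr m\<close> makes a translation harmless: it costs a constant factor only. For
\<open>m > 1\<close>, by contrast, a translation changes the exponent by an unbounded amount.\<close>
lemma weight_bound_sublinear:
  assumes "\<alpha> > 0" "0 < m" "m \<le> 1" "cmod l \<le> 1"
  shows "exp (- \<alpha> * cmod z powr m)
    \<le> exp (\<alpha> * cmod b powr m) * exp (- \<alpha> * cmod (b + l * z) powr m)"
proof -
  have "cmod (b + l * z) \<le> cmod b + cmod z"
    using norm_triangle_ineq[of b "l * z"] mult_right_mono[OF assms(4), of "cmod z"]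
    by (simp add: norm_mult)
  then have "cmod (b + l * z) powr m \<le> (cmod b + cmod z) powr m"
    using assms by (intro powr_mono2) auto
  also have "\<dots> \<le> cmod b powr m + cmod z powr m"
    using assms by (intro add_powr_le_powr_add_powr) auto
  finally have "\<alpha> * cmod (b + l * z) powr m \<le> \<alpha> * (cmod b powr m + cmod z powr m)"
    using assms by (intro mult_left_mono) auto
  then show ?thesis
    by (simp add: exp_add[symmetric] algebra_simps)
qed

text \<open>Choose \<open>s\<close> with \<open>\<rho> < s < 1\<close>. For large \<open>t\<close> one has \<open>\<beta> + \<rho> * t \<le> s * t\<close>, so the two power terms together
are at most \<open>- \<alpha> * (1 - s powr m) * t powr m\<close>, which absorbs the linear term because \<open>m > 1\<close>.
On the remaining bounded range the negative term is dropped and the others are increasing in \<open>t\<close>.\<close>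
lemma superlinear_exponent_bounded_above:
  fixes \<alpha> m \<rho> \<beta> \<delta> :: real
  assumes "\<alpha> > 0" "m > 1" "0 \<le> \<rho>" "\<rho> < 1" "0 \<le> \<beta>" "0 \<le> \<delta>"
  obtains M where "\<And>t. t \<ge> 0 \<Longrightarrow> \<delta> * t - \<alpha> * t powr m + \<alpha> * (\<beta> + \<rho> * t) powr m \<le> M"
proof -
  define s where "s = (\<rho> + 1) / 2"
  have s: "\<rho> < s" "0 < s" "s < 1"
    using assms by (auto simp: s_def)
  have "s powr m < 1 powr m"
    using s assms by (intro powr_less_mono2) auto
  then have sm: "1 - s powr m > 0"
    by simp
  define q where "q = \<delta> / (\<alpha> * (1 - s powr m))"
  have q: "q \<ge> 0"
    using assms sm by (simp add: q_def)
  define R where "R = max (\<beta> / (s - \<rho>)) (q powr (1 / (m - 1)))"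
  have R: "R \<ge> 0"
    by (simp add: R_def le_max_iff_disj)
  define M where "M = \<delta> * R + \<alpha> * (\<beta> + \<rho> * R) powr m"
  have "M \<ge> 0"
    using assms R by (simp add: M_def)
  show ?thesis
  proof
    fix t :: real assume t: "t \<ge> 0"
    show "\<delta> * t - \<alpha> * t powr m + \<alpha> * (\<beta> + \<rho> * t) powr m \<le> M"
    proof (cases "t \<le> R")
      case True
      have "\<delta> * t \<le> \<delta> * R"
        using True assms by (intro mult_left_mono) auto
      moreover have "\<alpha> * (\<beta> + \<rho> * t) powr m \<le> \<alpha> * (\<beta> + \<rho> * R) powr m"
        using True t assms by (intro mult_left_mono powr_mono2 add_mono) auto
      moreover have "0 \<le> \<alpha> * t powr m"
        using assms by simp
      ultimately show ?thesis
        by (simp add: M_def)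
    next
      case False
      then have "t > 0" "\<beta> / (s - \<rho>) \<le> t" "q powr (1 / (m - 1)) \<le> t"
        using R by (auto simp: R_def)
      have "\<beta> + \<rho> * t \<le> s * t"
        using \<open>\<beta> / (s - \<rho>) \<le> t\<close> s by (simp add: field_simps)
      then have "(\<beta> + \<rho> * t) powr m \<le> (s * t) powr m"
        using assms t by (intro powr_mono2) auto
      then have near: "(\<beta> + \<rho> * t) powr m \<le> s powr m * t powr m"
        using s t by (simp add: powr_mult)
      have "q = (q powr (1 / (m - 1))) powr (m - 1)"
        using q assms by (simp add: powr_powr)
      also have "\<dots> \<le> t powr (m - 1)"
        using \<open>q powr (1 / (m - 1)) \<le> t\<close> assms by (intro powr_mono2) auto
      finally have "q * t \<le> t powr (m - 1) * t"
        using t by (intro mult_right_mono) auto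
      also have "t powr (m - 1) * t = t powr m"
        using \<open>t > 0\<close> powr_add[of t "m - 1" 1] by simp
      finally have "\<alpha> * (1 - s powr m) * (q * t) \<le> \<alpha> * (1 - s powr m) * t powr m"
        using assms sm by (intro mult_left_mono) auto
      then have "\<delta> * t \<le> \<alpha> * (1 - s powr m) * t powr m"
        using assms sm by (simp add: q_def)
      moreover have "\<alpha> * (\<beta> + \<rho> * t) powr m \<le> \<alpha> * (s powr m * t powr m)"
        using near assms by (intro mult_left_mono) auto
      ultimately show ?thesis
        using \<open>M \<ge> 0\<close> by (simp add: algebra_simps)
    qed
  qed
qed

lemma weight_bound_superlinear:
  assumes "\<alpha> > 0" "m > 1" "cmod l < 1"
  obtains K where "K \<ge> 0" "\<And>z. (cmod (c * exp (d * z)))\<^sup>2 * exp (- \<alpha> * cmod z powr m)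
    \<le> K * exp (- \<alpha> * cmod (b + l * z) powr m)"
proof -
  obtain M where M: "\<And>t. t \<ge> 0 \<Longrightarrow>
      2 * cmod d * t - \<alpha> * t powr m + \<alpha> * (cmod b + cmod l * t) powr m \<le> M"
    using superlinear_exponent_bounded_above[of \<alpha> m "cmod l" "cmod b" "2 * cmod d"] assms by auto
  show ?thesis
  proof
    show "(cmod c)\<^sup>2 * exp M \<ge> 0" by simp
    fix z
    have "cmod (b + l * z) \<le> cmod b + cmod l * cmod z"
      using norm_triangle_ineq[of b "l * z"] by (simp add: norm_mult)
    then have "\<alpha> * cmod (b + l * z) powr m \<le> \<alpha> * (cmod b + cmod l * cmod z) powr m"
      using assms by (intro mult_left_mono powr_mono2) auto
    moreover have "Re (d * z) \<le> cmod d * cmod z"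
      using complex_Re_le_cmod[of "d * z"] by (simp add: norm_mult)
    ultimately have "2 * Re (d * z) - \<alpha> * cmod z powr m \<le> M - \<alpha> * cmod (b + l * z) powr m"
      using M[of "cmod z"] by simp
    then have "exp (2 * Re (d * z) + - \<alpha> * cmod z powr m) \<le> exp (M + - \<alpha> * cmod (b + l * z) powr m)"
      by simp
    then have "(cmod c)\<^sup>2 * exp (2 * Re (d * z) + - \<alpha> * cmod z powr m)
        \<le> (cmod c)\<^sup>2 * exp (M + - \<alpha> * cmod (b + l * z) powr m)"
      by (rule mult_left_mono) simp
    moreover have "(cmod (c * exp (d * z)))\<^sup>2 = (cmod c)\<^sup>2 * exp (2 * Re (d * z))"
      by (subst exp_double) (simp add: norm_mult power_mult_distrib del: times_complex.simps)
    ultimately show "(cmod (c * exp (d * z)))\<^sup>2 * exp (- \<alpha> * cmod z powr m)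
        \<le> (cmod c)\<^sup>2 * exp M * exp (- \<alpha> * cmod (b + l * z) powr m)"
      by (simp only: exp_add mult.assoc)
  qed
qed

text \<open>Integrability is obtained from the weight comparison for the contraction \<open>z \<mapsto> z / 2\<close>: it shows that
the corresponding weighted composition operator maps the constant function 1, which has finite
norm, to a function of finite norm, and this image is the exponential.\<close>
lemma exp_linear_in_fock_space:
  assumes "\<alpha> > 0" "m > 1"
  shows "(\<lambda>z. c * exp (d * z)) \<in> fock_space \<alpha> m"
proof -
  let ?\<psi> = "\<lambda>z. c * exp (d * z)"
  have hol: "?\<psi> holomorphic_on UNIV"
    by (intro holomorphic_intros)
  obtain K where K: "K \<ge> 0" "\<And>z. (cmod (?\<psi> z))\<^sup>2 * exp (- \<alpha> * cmod z powr m)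
      \<le> K * exp (- \<alpha> * cmod (0 + 1 / 2 * z) powr m)"
    using weight_bound_superlinear[OF assms, of "1 / 2" c d 0] by auto
  have "fock_energy \<alpha> m (\<lambda>z. ?\<psi> z * (\<lambda>_. 1) (0 + 1 / 2 * z))
      \<le> ennreal (K / (cmod (1 / 2))\<^sup>2) * fock_energy \<alpha> m (\<lambda>_. 1)"
    using assms K by (intro fock_energy_affine_le[OF _ _ _ _ hol, where b = 0 and l = "1 / 2"]) auto
  also have "\<dots> < \<infinity>"
    using monomial_in_fock_space[of \<alpha> m 0] assms
    by (simp add: fock_space_iff_energy ennreal_mult_less_top)
  finally show ?thesis
    using hol by (simp add: fock_space_iff_energy)
qed

section \<open>Sufficient conditions for boundedness\<close>

text \<open>If \<open>l = 0\<close>, no substitution is possible, but the operator is \<open>f \<mapsto> f b * \<psi>\<close>, and its boundedness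
amounts to continuity of point evaluation together with \<open>\<psi>\<close> being in the space.\<close>
lemma fock_bounded_weighted_comp_affineI:
  assumes "\<alpha> > 0" "m > 0" "\<psi> \<in> fock_space \<alpha> m" "\<And>z. \<phi> z = b + l * z" "K \<ge> 0"
    and weight: "\<And>z. (cmod (\<psi> z))\<^sup>2 * exp (- \<alpha> * cmod z powr m)
      \<le> K * exp (- \<alpha> * cmod (b + l * z) powr m)"
  shows "fock_bounded \<alpha> m (weighted_comp \<psi> \<phi>)"
proof -
  have \<psi>: "\<psi> holomorphic_on UNIV" "fock_energy \<alpha> m \<psi> < \<infinity>"
    using assms(3) by (auto simp: fock_space_iff_energy)
  have \<phi>: "\<phi> = (\<lambda>z. b + l * z)"
    using assms(4) by auto
  have \<phi>_hol: "\<phi> holomorphic_on UNIV"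
    unfolding \<phi> by (intro holomorphic_intros)
  show ?thesis
  proof (cases "l = 0")
    case False
    show ?thesis
    proof (rule fock_bounded_weighted_compI[OF \<psi>(1) \<phi>_hol])
      show "0 \<le> K / (cmod l)\<^sup>2"
        using assms by simp
      show "fock_energy \<alpha> m (weighted_comp \<psi> \<phi> f) \<le> ennreal (K / (cmod l)\<^sup>2) * fock_energy \<alpha> m f"
        if "f \<in> fock_space \<alpha> m" for f
        using that fock_energy_affine_le[OF assms(1,2) False assms(5) \<psi>(1) _ weight, of f]
        by (simp add: weighted_comp_def \<phi> fock_space_iff_energy)
    qed
  next
    case True
    obtain P where P: "P \<ge> 0" "\<And>f. f holomorphic_on UNIV \<Longrightarrow>
        ennreal ((cmod (f b))\<^sup>2) \<le> ennreal P * fock_energy \<alpha> m f"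
      using point_evaluation_bound[OF assms(1,2)]
      by (metis exp_ge_zero mult_nonneg_nonneg)
    obtain e where e: "e \<ge> 0" "fock_energy \<alpha> m \<psi> = ennreal e"
      using \<psi>(2) by (cases "fock_energy \<alpha> m \<psi>") auto
    show ?thesis
    proof (rule fock_bounded_weighted_compI[OF \<psi>(1) \<phi>_hol])
      show "0 \<le> P * e"
        using P e by simp
      fix f assume "f \<in> fock_space \<alpha> m"
      then have "ennreal ((cmod (f b))\<^sup>2) \<le> ennreal P * fock_energy \<alpha> m f"
        by (intro P(2)) (simp add: fock_space_iff_energy)
      then have "ennreal ((cmod (f b))\<^sup>2) * fock_energy \<alpha> m \<psi>
          \<le> ennreal P * fock_energy \<alpha> m f * fock_energy \<alpha> m \<psi>"
        by (intro mult_right_mono) auto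
      moreover have "fock_energy \<alpha> m (weighted_comp \<psi> \<phi> f) = ennreal ((cmod (f b))\<^sup>2) * fock_energy \<alpha> m \<psi>"
        using fock_energy_cmult[OF \<psi>(1), of \<alpha> m "f b"]
        by (simp add: weighted_comp_def \<phi> True mult.commute)
      ultimately show "fock_energy \<alpha> m (weighted_comp \<psi> \<phi> f) \<le> ennreal (P * e) * fock_energy \<alpha> m f"
        using P e by (simp add: ennreal_mult mult_ac)
    qed
  qed
qed

section \<open>Necessary conditions for boundedness\<close>

text \<open>Along the ray in the direction of \<open>cnj d\<close> the function grows like \<open>exp (cmod d * t)\<close>, whereas by the
point evaluation bound the square of a member of the space grows at most like
\<open>exp (\<alpha> * (t + 1) powr m)\<close>; for \<open>m < 1\<close> the latter is of smaller order.\<close>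
lemma exp_linear_in_fock_space_imp_constant:
  assumes "\<alpha> > 0" "0 < m" "m < 1" "c \<noteq> 0"
    and mem: "(\<lambda>z. c * exp (d * z)) \<in> fock_space \<alpha> m"
  shows "d = 0"
proof (rule ccontr)
  assume "d \<noteq> 0"
  let ?\<psi> = "\<lambda>z. c * exp (d * z)"
  obtain K where "K \<ge> 0" and point: "\<And>f p. f holomorphic_on UNIV \<Longrightarrow> ennreal ((cmod (f p))\<^sup>2)
      \<le> ennreal (K * exp (\<alpha> * (cmod p + 1) powr m)) * fock_energy \<alpha> m f"
    using point_evaluation_bound[OF assms(1,2)] by metis
  have "?\<psi> holomorphic_on UNIV"
    by (intro holomorphic_intros)
  note K = \<open>K \<ge> 0\<close> point[OF this]
  obtain e where e: "e \<ge> 0" "fock_energy \<alpha> m ?\<psi> = ennreal e"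
    using mem by (cases "fock_energy \<alpha> m ?\<psi>") (auto simp: fock_space_iff_energy)
  have bound: "(cmod c)\<^sup>2 * exp (2 * cmod d * t - \<alpha> * (t + 1) powr m) \<le> K * e" if t: "t \<ge> 0" for t
  proof -
    define p where "p = of_real t * cnj d / of_real (cmod d)"
    have p: "cmod p = t" "d * p = of_real (cmod d * t)"
      using t \<open>d \<noteq> 0\<close>
      by (simp_all add: p_def norm_mult norm_divide complex_norm_square[symmetric] power2_eq_square
          mult.left_commute[of d])
    have "ennreal ((cmod (?\<psi> p))\<^sup>2) \<le> ennreal (K * exp (\<alpha> * (t + 1) powr m) * e)"
      using K(2)[of p] K(1) e by (simp add: p(1) ennreal_mult[symmetric])
    then have "(cmod (?\<psi> p))\<^sup>2 \<le> K * exp (\<alpha> * (t + 1) powr m) * e"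
      using K(1) e by (simp add: ennreal_le_iff)
    moreover have "(cmod (?\<psi> p))\<^sup>2 = (cmod c)\<^sup>2 * exp (2 * cmod d * t)"
      by (simp add: p(2) norm_mult power_mult_distrib exp_double[symmetric] mult.assoc)
    ultimately show ?thesis
      by (simp add: exp_diff field_simps)
  qed
  have "filterlim (\<lambda>t. (cmod c)\<^sup>2 * exp (2 * cmod d * t - \<alpha> * (t + 1) powr m)) at_top at_top"
  proof -
    have "0 < cmod d" "0 < (cmod c)\<^sup>2"
      using \<open>d \<noteq> 0\<close> \<open>c \<noteq> 0\<close> by auto
    then show ?thesis
      using assms(1-3) by real_asymp
  qed
  then have "eventually (\<lambda>t. (cmod c)\<^sup>2 * exp (2 * cmod d * t - \<alpha> * (t + 1) powr m) > K * e) at_top"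
    by (simp add: filterlim_at_top_dense)
  then have "eventually (\<lambda>t::real. False) at_top"
    using eventually_ge_at_top[of 0] by eventually_elim (use bound in force)
  then show False
    by simp
qed

lemma fock_energy_reflect:
  assumes "\<alpha> > 0" "m > 0" "f holomorphic_on UNIV"
  shows "fock_energy \<alpha> m (\<lambda>z. f (- z)) = fock_energy \<alpha> m f"
proof -
  note [measurable] = holomorphic_borel[OF assms(3)]
  show ?thesis
    using assms(1,2)
    by (simp add: fock_energy_lborel)
       (subst (2) nn_integral_complex_affine[of _ "-1" 0], auto)
qed

text \<open>Since \<open>2 * l * z = (b + l * z) - (b - l * z)\<close>, at each point one of \<open>b + l * z\<close> and \<open>b - l * z\<close> has at
least the modulus of \<open>l * z\<close>. The Fock measure is invariant under \<open>z \<mapsto> - z\<close>, so both have powers of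
the same energy. The factor 2 lost in comparison with the orthogonality of the monomials is
harmless, as \<open>n\<close> will tend to infinity.\<close>
lemma affine_power_energy_ge:
  assumes "\<alpha> > 0" "m > 0"
  shows "ennreal (cmod l ^ (2 * n)) * fock_energy \<alpha> m (\<lambda>z. z ^ n)
    \<le> 2 * fock_energy \<alpha> m (\<lambda>z. (b + l * z) ^ n)"
proof -
  have pointwise: "cmod l ^ (2 * n) * (cmod (z ^ n))\<^sup>2
      \<le> (cmod ((b + l * z) ^ n))\<^sup>2 + (cmod ((b + l * - z) ^ n))\<^sup>2" for z
  proof -
    have "2 * cmod (l * z) = cmod ((b + l * z) - (b + l * - z))"
      by (simp flip: norm_mult_numeral1)
    also have "\<dots> \<le> cmod (b + l * z) + cmod (b + l * - z)"
      by (rule norm_triangle_ineq4)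
    finally have "cmod (l * z) \<le> cmod (b + l * z) \<or> cmod (l * z) \<le> cmod (b + l * - z)"
      by linarith
    then have "cmod (l * z) ^ (2 * n) \<le> cmod (b + l * z) ^ (2 * n)
        \<or> cmod (l * z) ^ (2 * n) \<le> cmod (b + l * - z) ^ (2 * n)"
      by (meson norm_ge_zero power_mono)
    then have "cmod (l * z) ^ (2 * n) \<le> cmod (b + l * z) ^ (2 * n) + cmod (b + l * - z) ^ (2 * n)"
      using zero_le_power[OF norm_ge_zero, of "b + l * z" "2 * n"]
        zero_le_power[OF norm_ge_zero, of "b + l * - z" "2 * n"] by linarith
    then show ?thesis
      by (simp add: norm_mult norm_power power_mult_distrib power_mult[symmetric] mult.commute[of n])
  qed
  have "ennreal (cmod l ^ (2 * n)) * fock_energy \<alpha> m (\<lambda>z. z ^ n)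
      = (\<integral>\<^sup>+z. ennreal (cmod l ^ (2 * n) * (cmod (z ^ n))\<^sup>2) \<partial>fock_measure \<alpha> m)"
    unfolding fock_energy_def by (simp add: ennreal_mult nn_integral_cmult)
  also have "\<dots> \<le> (\<integral>\<^sup>+z. ennreal ((cmod ((b + l * z) ^ n))\<^sup>2)
      + ennreal ((cmod ((b + l * - z) ^ n))\<^sup>2) \<partial>fock_measure \<alpha> m)"
    using pointwise by (intro nn_integral_mono) (simp add: ennreal_plus[symmetric] ennreal_leI del: ennreal_plus)
  also have "\<dots> = fock_energy \<alpha> m (\<lambda>z. (b + l * z) ^ n) + fock_energy \<alpha> m (\<lambda>z. (b + l * - z) ^ n)"
    unfolding fock_energy_def by (rule nn_integral_add) auto
  also have "fock_energy \<alpha> m (\<lambda>z. (b + l * - z) ^ n) = fock_energy \<alpha> m (\<lambda>z. (b + l * z) ^ n)"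
    by (rule fock_energy_reflect[OF assms]) (intro holomorphic_intros)
  finally show ?thesis
    by (simp add: mult_2)
qed

text \<open>Applied to \<open>z ^ n\<close>, the operator multiplies the energy by at least \<open>(cmod c)\<^sup>2 * cmod l ^ (2 * n) / 2\<close>,
which is unbounded in \<open>n\<close> if \<open>cmod l > 1\<close>.\<close>
lemma fock_bounded_constant_weight_imp:
  assumes "\<alpha> > 0" "m > 0" "c \<noteq> 0" "\<And>z. \<phi> z = b + l * z"
    and "fock_bounded \<alpha> m (weighted_comp (\<lambda>_. c) \<phi>)"
  shows "cmod l \<le> 1"
proof (rule ccontr)
  assume "\<not> cmod l \<le> 1"
  obtain K where K: "K \<ge> 0" "\<And>f. f \<in> fock_space \<alpha> m \<Longrightarrow>
      fock_energy \<alpha> m (weighted_comp (\<lambda>_. c) \<phi> f) \<le> ennreal K * fock_energy \<alpha> m f"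
    using fock_boundedD[OF assms(5)] by blast
  have bound: "(cmod c)\<^sup>2 * cmod l ^ (2 * n) \<le> 2 * K" for n
  proof -
    let ?z = "\<lambda>z::complex. z ^ n"
    have mem: "?z \<in> fock_space \<alpha> m"
      by (rule monomial_in_fock_space[OF assms(1,2)])
    obtain e where e: "e \<ge> 0" "fock_energy \<alpha> m ?z = ennreal e"
      using mem by (cases "fock_energy \<alpha> m ?z") (auto simp: fock_space_iff_energy)
    obtain P where "ennreal ((cmod (?z 1))\<^sup>2) \<le> ennreal P * fock_energy \<alpha> m ?z"
      using point_evaluation_bound[OF assms(1,2)] mem
      unfolding fock_space_iff_energy by metis
    \<comment> \<open>The energy of \<open>z ^ n\<close> has to be cancelled below; it is positive since \<open>z ^ n\<close> is 1 at 1.\<close>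
    then have "e \<noteq> 0"
      using e by auto
    have "weighted_comp (\<lambda>_. c) \<phi> ?z = (\<lambda>z. c * (b + l * z) ^ n)"
      by (auto simp: weighted_comp_def assms(4))
    then have "fock_energy \<alpha> m (weighted_comp (\<lambda>_. c) \<phi> ?z)
        = ennreal ((cmod c)\<^sup>2) * fock_energy \<alpha> m (\<lambda>z. (b + l * z) ^ n)"
      by (simp add: fock_energy_cmult holomorphic_intros)
    with K(2)[OF mem] have "ennreal ((cmod c)\<^sup>2) * fock_energy \<alpha> m (\<lambda>z. (b + l * z) ^ n)
        \<le> ennreal K * fock_energy \<alpha> m ?z"
      by simp
    then have "2 * (ennreal ((cmod c)\<^sup>2) * fock_energy \<alpha> m (\<lambda>z. (b + l * z) ^ n))
        \<le> 2 * (ennreal K * fock_energy \<alpha> m ?z)"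
      by (rule mult_left_mono) simp
    moreover have "ennreal ((cmod c)\<^sup>2) * (ennreal (cmod l ^ (2 * n)) * fock_energy \<alpha> m ?z)
        \<le> ennreal ((cmod c)\<^sup>2) * (2 * fock_energy \<alpha> m (\<lambda>z. (b + l * z) ^ n))"
      by (intro mult_left_mono affine_power_energy_ge assms(1,2)) auto
    ultimately have "ennreal ((cmod c)\<^sup>2) * (ennreal (cmod l ^ (2 * n)) * fock_energy \<alpha> m ?z)
        \<le> 2 * (ennreal K * fock_energy \<alpha> m ?z)"
      by (simp add: mult.left_commute)
    then have "ennreal ((cmod c)\<^sup>2 * cmod l ^ (2 * n) * e) \<le> ennreal (2 * K * e)"
      using e K(1) by (simp add: ennreal_mult mult.assoc)
    then have "(cmod c)\<^sup>2 * cmod l ^ (2 * n) * e \<le> 2 * K * e"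
      using e K(1) by (subst (asm) ennreal_le_iff) auto
    then show ?thesis
      using \<open>e \<noteq> 0\<close> e by simp
  qed
  have "1 < (cmod l)\<^sup>2"
    using \<open>\<not> cmod l \<le> 1\<close> by (simp add: one_less_power)
  then obtain n where "2 * K / (cmod c)\<^sup>2 < ((cmod l)\<^sup>2) ^ n"
    using real_arch_pow by blast
  moreover have "(cmod c)\<^sup>2 * ((cmod l)\<^sup>2) ^ n \<le> 2 * K"
    using bound[of n] unfolding power_mult .
  ultimately show False
    using assms(3) by (simp add: field_simps)
qed

section \<open>The boundedness criterion\<close>

theorem proposition5p1:
  fixes \<alpha> :: real and \<phi> \<psi> :: "complex \<Rightarrow> complex" and l c d :: complex
  assumes "\<alpha> > 0"
    and "\<And>z. \<phi> z = \<phi> 0 + l * z"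
    and "\<And>z. \<psi> z = c * exp (d * z)"
    and "c \<noteq> 0"
  shows "(\<forall>m::real. 0 < m \<and> m < 1 \<longrightarrow>
            (fock_bounded \<alpha> m (weighted_comp \<psi> \<phi>) \<longleftrightarrow> cmod l \<le> 1 \<and> d = 0)) \<and>
         (\<forall>m::real. m > 1 \<longrightarrow> cmod l < 1 \<longrightarrow> fock_bounded \<alpha> m (weighted_comp \<psi> \<phi>))"
proof (intro conjI allI impI)
  have \<psi>: "\<psi> = (\<lambda>z. c * exp (d * z))"
    using assms(3) by auto
  show "fock_bounded \<alpha> m (weighted_comp \<psi> \<phi>)" if m: "m > 1" "cmod l < 1" for m
  proof -
    obtain K where "K \<ge> 0" "\<And>z. (cmod (c * exp (d * z)))\<^sup>2 * exp (- \<alpha> * cmod z powr m)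
        \<le> K * exp (- \<alpha> * cmod (\<phi> 0 + l * z) powr m)"
      using weight_bound_superlinear[OF assms(1) m] by blast
    then show ?thesis
      using assms(1) m exp_linear_in_fock_space[OF assms(1) m(1)] unfolding \<psi>
      by (intro fock_bounded_weighted_comp_affineI[OF _ _ _ assms(2)]) auto
  qed
  show "fock_bounded \<alpha> m (weighted_comp \<psi> \<phi>) \<longleftrightarrow> cmod l \<le> 1 \<and> d = 0"
    if m: "0 < m \<and> m < 1" for m
  proof
    assume bounded: "fock_bounded \<alpha> m (weighted_comp \<psi> \<phi>)"
    have "(\<lambda>_. 1) \<in> fock_space \<alpha> m"
      using monomial_in_fock_space[of \<alpha> m 0] assms(1) m by simp
    then have "weighted_comp \<psi> \<phi> (\<lambda>_. 1) \<in> fock_space \<alpha> m"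
      using bounded by (simp add: fock_bounded_def)
    then have "(\<lambda>z. c * exp (d * z)) \<in> fock_space \<alpha> m"
      by (simp add: weighted_comp_def \<psi> o_def)
    then have "d = 0"
      using exp_linear_in_fock_space_imp_constant assms(1,4) m by blast
    moreover from this have "cmod l \<le> 1"
      using fock_bounded_constant_weight_imp[OF assms(1) _ assms(4,2), of m] bounded m by (simp add: \<psi>)
    ultimately show "cmod l \<le> 1 \<and> d = 0"
      by simp
  next
    assume l: "cmod l \<le> 1 \<and> d = 0"
    have one: "(\<lambda>_. 1) \<in> fock_space \<alpha> m"
      using monomial_in_fock_space[of \<alpha> m 0] assms(1) m by simp
    have \<psi>_const: "\<psi> = (\<lambda>z. c * (\<lambda>_. 1) z)"
      using l by (simp add: \<psi>)
    have "\<psi> \<in> fock_space \<alpha> m"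
      using one unfolding \<psi>_const fock_space_iff_energy
      by (subst fock_energy_cmult) (auto simp: ennreal_mult_less_top)
    moreover have "(cmod (\<psi> z))\<^sup>2 * exp (- \<alpha> * cmod z powr m)
        \<le> ((cmod c)\<^sup>2 * exp (\<alpha> * cmod (\<phi> 0) powr m)) * exp (- \<alpha> * cmod (\<phi> 0 + l * z) powr m)" for z
      using mult_left_mono[OF weight_bound_sublinear[of \<alpha> m l z "\<phi> 0"], of "(cmod c)\<^sup>2"] assms(1) m l
      by (simp add: \<psi> mult.assoc)
    ultimately show "fock_bounded \<alpha> m (weighted_comp \<psi> \<phi>)"
      using assms(1) m by (intro fock_bounded_weighted_comp_affineI[OF _ _ _ assms(2),
        where K = "(cmod c)\<^sup>2 * exp (\<alpha> * cmod (\<phi> 0) powr m)"]) auto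
  qed
qed

end
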